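(* For any integer $n\ge 4$ and any prime power $q$, the Grassmann graph $J_q(n,2)$ is not triply transitive.
   Context: $J_q(n,2)$ has as vertices the $2$-dimensional subspaces of $\mathbb F_q^n$, two being adjacent iff their intersection is $1$-dimensional. For a strongly regular graph $\Gamma=(V,E)$: $A_0=I$, $A_1$ its adjacency matrix, $A_2=J-I-A_1$; for a vertex $\omega$, $E^*_{i,\omega}$ ($i=0,1,2$) is the diagonal matrix whose diagonal is the $\omega$-row of $A_i$; $T_\omega$ is the algebra generated by $A_0,A_1,A_2,E^*_{0,\omega},E^*_{1,\omega},E^*_{2,\omega}$; $T_{0,\omega}$ is the span of all $E^*_{i,\omega}A_jE^*_{k,\omega}$; $\tilde T_\omega$ is the algebra of complex matrices commuting with the permutation matrices of the stabilizer $G_\omega$ in $G=\mathrm{Aut}(\Gamma)$. $\Gamma$ is triply transitive if $G$ is transitive and $T_{0,\omega}=T_\omega=\tilde T_\omega$ for some (equivalently every) vertex $\omega$. *)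

theory Defs
  imports "HOL-Analysis.Analysis" "HOL-Combinatorics.Permutations"
begin

text \<open>
  A finite graph is given by a vertex set V inside a finite type and an adjacency relation, which
  is only looked at on V. A complex matrix with rows and columns indexed by V is represented by the
  matrix over the whole type that has it as its block at V and is zero elsewhere
  (\<open>supported_on\<close>). Sums, scalar multiples and products (\<open>**\<close>) of such matrices are
  computed on the block. The identity matrix on V is thus \<open>id_mat V\<close>, not \<open>mat 1\<close>.
\<close>

type_synonym 'v cmat = "complex^'v^'v"

definition cmat_scale :: "complex \<Rightarrow> 'v::finite cmat \<Rightarrow> 'v cmat" where
  "cmat_scale c M = (\<chi> x y. c * M $ x $ y)"

interpretation cmat: vector_space "cmat_scale :: complex \<Rightarrow> 'v::finite cmat \<Rightarrow> 'v cmat"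
  by unfold_locales (simp_all add: cmat_scale_def vec_eq_iff algebra_simps)

definition supported_on :: "'v set \<Rightarrow> 'v::finite cmat \<Rightarrow> bool" where
  "supported_on V M \<longleftrightarrow> (\<forall>x y. x \<notin> V \<or> y \<notin> V \<longrightarrow> M $ x $ y = 0)"

definition id_mat :: "'v set \<Rightarrow> 'v::finite cmat" where
  "id_mat V = (\<chi> x y. if x \<in> V \<and> y \<in> V \<and> x = y then 1 else 0)"

definition all_one_mat :: "'v set \<Rightarrow> 'v::finite cmat" where
  "all_one_mat V = (\<chi> x y. if x \<in> V \<and> y \<in> V then 1 else 0)"

definition adj_mat :: "'v set \<Rightarrow> ('v \<Rightarrow> 'v \<Rightarrow> bool) \<Rightarrow> 'v::finite cmat" where
  "adj_mat V adj = (\<chi> x y. if x \<in> V \<and> y \<in> V \<and> adj x y then 1 else 0)"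

text \<open>The matrices \<open>A\<^sub>i\<close> and \<open>E\<^sup>*\<^sub>i\<^sub>,\<^sub>\<omega>\<close>; only the indices
  \<open>i \<le> 2\<close> are used.\<close>

definition assoc_mat :: "'v set \<Rightarrow> ('v \<Rightarrow> 'v \<Rightarrow> bool) \<Rightarrow> nat \<Rightarrow> 'v::finite cmat" where
  "assoc_mat V adj i =
     (if i = 0 then id_mat V
      else if i = 1 then adj_mat V adj
      else all_one_mat V - id_mat V - adj_mat V adj)"

definition dual_idem ::
  "'v set \<Rightarrow> ('v \<Rightarrow> 'v \<Rightarrow> bool) \<Rightarrow> 'v \<Rightarrow> nat \<Rightarrow> 'v::finite cmat" where
  "dual_idem V adj \<omega> i = (\<chi> x y. if x = y then assoc_mat V adj i $ \<omega> $ x else 0)"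

definition generated_algebra :: "'v::finite cmat set \<Rightarrow> 'v cmat set" where
  "generated_algebra S =
     (\<lambda>W. cmat.subspace W \<and> (\<forall>M\<in>W. \<forall>N\<in>W. M ** N \<in> W)) hull S"

definition terwilliger_algebra ::
  "'v set \<Rightarrow> ('v \<Rightarrow> 'v \<Rightarrow> bool) \<Rightarrow> 'v \<Rightarrow> 'v::finite cmat set" where
  "terwilliger_algebra V adj \<omega> =
     generated_algebra (assoc_mat V adj ` {..2} \<union> dual_idem V adj \<omega> ` {..2})"

definition triple_span ::
  "'v set \<Rightarrow> ('v \<Rightarrow> 'v \<Rightarrow> bool) \<Rightarrow> 'v \<Rightarrow> 'v::finite cmat set" where
  "triple_span V adj \<omega> =
     cmat.span {dual_idem V adj \<omega> i ** assoc_mat V adj j ** dual_idem V adj \<omega> k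
                | i j k. i \<le> 2 \<and> j \<le> 2 \<and> k \<le> 2}"

text \<open>By \<open>permutes\<close>, an automorphism is the identity outside V, so that it is determined
  by its restriction to V.\<close>

definition graph_auts :: "'v set \<Rightarrow> ('v \<Rightarrow> 'v \<Rightarrow> bool) \<Rightarrow> ('v \<Rightarrow> 'v) set" where
  "graph_auts V adj =
     {g. g permutes V \<and> (\<forall>x\<in>V. \<forall>y\<in>V. adj (g x) (g y) \<longleftrightarrow> adj x y)}"

definition perm_mat :: "'v set \<Rightarrow> ('v \<Rightarrow> 'v) \<Rightarrow> 'v::finite cmat" where
  "perm_mat V g = (\<chi> x y. if x \<in> V \<and> y \<in> V \<and> x = g y then 1 else 0)"

definition stabilizer_centralizer ::
  "'v set \<Rightarrow> ('v \<Rightarrow> 'v \<Rightarrow> bool) \<Rightarrow> 'v \<Rightarrow> 'v::finite cmat set" where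
  "stabilizer_centralizer V adj \<omega> =
     {M. supported_on V M \<and>
         (\<forall>g\<in>graph_auts V adj. g \<omega> = \<omega> \<longrightarrow> perm_mat V g ** M = M ** perm_mat V g)}"

text \<open>The notion is meant for strongly regular graphs, but the condition makes sense for every
  finite graph. Strong regularity is not made part of it, so its negation cannot hold merely
  for lack of strong regularity.\<close>

definition triply_transitive :: "'v::finite set \<Rightarrow> ('v \<Rightarrow> 'v \<Rightarrow> bool) \<Rightarrow> bool" where
  "triply_transitive V adj \<longleftrightarrow>
     (\<forall>x\<in>V. \<forall>y\<in>V. \<exists>g\<in>graph_auts V adj. g x = y) \<and>
     (\<exists>\<omega>\<in>V. triple_span V adj \<omega> = terwilliger_algebra V adj \<omega> \<and>
             terwilliger_algebra V adj \<omega> = stabilizer_centralizer V adj \<omega>)"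

text \<open>The Grassmann graph \<open>J\<^sub>q(n,2)\<close>, with \<open>q = CARD('a)\<close> and \<open>n = CARD('n)\<close>.
  Vertices are sets of vectors, so the matrices above are indexed by the finite type
  \<open>('a^'n) set\<close>.\<close>

definition grassmann2_verts :: "('a::{field,finite}^'n) set set" where
  "grassmann2_verts = {U. vec.subspace U \<and> vec.dim U = 2}"

definition grassmann2_adj :: "('a::{field,finite}^'n) set \<Rightarrow> ('a^'n) set \<Rightarrow> bool" where
  "grassmann2_adj U W \<longleftrightarrow> vec.dim (U \<inter> W) = 1"

end

theory Submission
  imports Defs
begin

text \<open>
  The entry of \<open>A\<^sub>1 E\<^sup>*\<^sub>1 A\<^sub>1\<close> at \<open>(x, y)\<close> counts the common neighbours of
  \<open>\<omega>\<close>, \<open>x\<close>, \<open>y\<close>. If this matrix, which lies in the Terwilliger algebra, were a combination of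
  the \<open>E\<^sup>*\<^sub>i A\<^sub>j E\<^sup>*\<^sub>k\<close>, then all triangles through \<open>\<omega>\<close> would have the same number of common
  neighbours. But view the vertices as lines of the projective space and take three lines through
  a point \<open>p\<close>. If they are not coplanar, their common neighbours are the other lines
  through \<open>p\<close>; if they are coplanar, the lines of the plane that avoid \<open>p\<close> come in addition.
\<close>

lemma matrix_mult_dual_idem_nth:
  "(M ** dual_idem V adj \<omega> k) $ x $ y = M $ x $ y * assoc_mat V adj k $ \<omega> $ y"
  by (simp add: dual_idem_def matrix_matrix_mult_def if_distrib sum.delta' cong: if_cong)

lemma dual_idem_matrix_mult_nth:
  "(dual_idem V adj \<omega> k ** M) $ x $ y = assoc_mat V adj k $ \<omega> $ x * M $ x $ y"
  by (simp add: dual_idem_def matrix_matrix_mult_def if_distrib[of "\<lambda>c. c * _"] sum.delta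
      cong: if_cong)

text \<open>The entry of a generator at \<open>(x, y)\<close> is the product of an entry at
  \<open>(\<omega>, x)\<close>, one at \<open>(x, y)\<close> and one at
  \<open>(\<omega>, y)\<close>, so it depends only on the relations within the triple. Equality of
  two fixed entries is a linear condition and hence passes to the span.\<close>

lemma triple_span_nth_eq:
  assumes M: "M \<in> triple_span V adj \<omega>"
    and rels: "\<And>i. assoc_mat V adj i $ \<omega> $ x = assoc_mat V adj i $ \<omega> $ x'"
      "\<And>i. assoc_mat V adj i $ \<omega> $ y = assoc_mat V adj i $ \<omega> $ y'"
      "\<And>i. assoc_mat V adj i $ x $ y = assoc_mat V adj i $ x' $ y'"
  shows "M $ x $ y = M $ x' $ y'"
proof -
  let ?W = "{M. M $ x $ y = M $ x' $ y'}"
  have "cmat.subspace ?W"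
    by (auto simp: cmat.subspace_def cmat_scale_def)
  moreover have "{dual_idem V adj \<omega> i ** assoc_mat V adj j ** dual_idem V adj \<omega> k
                | i j k. i \<le> 2 \<and> j \<le> 2 \<and> k \<le> 2} \<subseteq> ?W"
    using rels by (auto simp: matrix_mult_dual_idem_nth dual_idem_matrix_mult_nth)
  ultimately show ?thesis
    using M cmat.span_minimal unfolding triple_span_def by blast
qed

lemma generated_algebra_superset: "S \<subseteq> generated_algebra S"
  unfolding generated_algebra_def by (rule hull_subset)

lemma generated_algebra_mult:
  "M \<in> generated_algebra S \<Longrightarrow> N \<in> generated_algebra S \<Longrightarrow> M ** N \<in> generated_algebra S"
  unfolding generated_algebra_def hull_def by blast

lemma assoc_mat_adjacent:
  assumes "x \<in> V" "y \<in> V" "x \<noteq> y" "adj x y"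
  shows "assoc_mat V adj i $ x $ y = (if i = 1 then 1 else 0)"
  using assms by (simp add: assoc_mat_def id_mat_def adj_mat_def all_one_mat_def)

lemma adj_dual_adj_nth:
  fixes \<omega> :: "'v::finite"
  assumes "\<omega> \<in> V" "x \<in> V" "y \<in> V"
  shows "(assoc_mat V adj 1 ** dual_idem V adj \<omega> 1 ** assoc_mat V adj 1) $ x $ y =
    of_nat (card {z \<in> V. adj x z \<and> adj \<omega> z \<and> adj z y})"
proof -
  have "(assoc_mat V adj 1 ** dual_idem V adj \<omega> 1 ** assoc_mat V adj 1) $ x $ y =
    (\<Sum>z\<in>UNIV. if z \<in> V \<and> adj x z \<and> adj \<omega> z \<and> adj z y then 1 else 0)"
    using assms
    by (subst matrix_matrix_mult_def)
      (auto simp: matrix_mult_dual_idem_nth assoc_mat_def adj_mat_def intro!: sum.cong)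
  also have "\<dots> = of_nat (card {z \<in> V. adj x z \<and> adj \<omega> z \<and> adj z y})"
    by (simp flip: sum.inter_filter)
  finally show ?thesis .
qed

lemma card_common_neighbours_eq:
  fixes \<omega> :: "'v::finite"
  assumes T: "triple_span V adj \<omega> = terwilliger_algebra V adj \<omega>"
    and V: "\<omega> \<in> V" "x \<in> V" "y \<in> V" "x' \<in> V" "y' \<in> V"
    and irrefl: "\<And>z. z \<in> V \<Longrightarrow> \<not> adj z z"
    and adj: "adj \<omega> x" "adj \<omega> y" "adj x y" "adj \<omega> x'" "adj \<omega> y'" "adj x' y'"
  shows "card {z \<in> V. adj x z \<and> adj \<omega> z \<and> adj z y} = card {z \<in> V. adj x' z \<and> adj \<omega> z \<and> adj z y'}"
proof -
  let ?M = "assoc_mat V adj 1 ** dual_idem V adj \<omega> 1 ** assoc_mat V adj 1"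
  let ?S = "assoc_mat V adj ` {..2} \<union> dual_idem V adj \<omega> ` {..2}"
  have "assoc_mat V adj 1 \<in> ?S" "dual_idem V adj \<omega> 1 \<in> ?S"
    by auto
  then have "?M \<in> terwilliger_algebra V adj \<omega>"
    unfolding terwilliger_algebra_def
    by (intro generated_algebra_mult) (rule subsetD[OF generated_algebra_superset], assumption)+
  then have M: "?M \<in> triple_span V adj \<omega>"
    by (simp add: T)
  \<comment> \<open>Distinct and adjacent vertices have entry 1 in \<open>A_1\<close> and 0 in
    \<open>A_0\<close> and \<open>A_2\<close>, so the two triangles agree in all their
    relations.\<close>
  have ne: "\<omega> \<noteq> x" "\<omega> \<noteq> y" "x \<noteq> y" "\<omega> \<noteq> x'" "\<omega> \<noteq> y'" "x' \<noteq> y'"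
    using V irrefl adj by auto
  have "?M $ x $ y = ?M $ x' $ y'"
    by (rule triple_span_nth_eq[OF M]) (simp_all only: assoc_mat_adjacent V adj ne not_False_eq_True)
  then show ?thesis
    unfolding adj_dual_adj_nth[OF V(1,2,3)] adj_dual_adj_nth[OF V(1,4,5)] of_nat_eq_iff .
qed

lemma span_pair_in_grassmann2_verts:
  assumes "a \<noteq> 0" "b \<notin> vec.span {a}"
  shows "vec.span {a, b} \<in> grassmann2_verts"
proof -
  have "vec.dim {b, a} = 2"
    using assms by (simp add: vec.dim_insert)
  then show ?thesis
    by (simp add: grassmann2_verts_def insert_commute)
qed

text \<open>The intersection has dimension at most 2; dimension 2 forces equality and dimension 0 a
  trivial intersection. Adjacency of distinct vertices can thus be certified by a nonzero common
  vector.\<close>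

lemma grassmann2_adj_iff:
  assumes "U \<in> grassmann2_verts" "W \<in> grassmann2_verts"
  shows "grassmann2_adj U W \<longleftrightarrow> U \<noteq> W \<and> (\<exists>a. a \<noteq> 0 \<and> a \<in> U \<and> a \<in> W)"
proof -
  have s: "vec.subspace U" "vec.subspace W" "vec.subspace (U \<inter> W)"
    and d: "vec.dim U = 2" "vec.dim W = 2"
    using assms by (auto simp: grassmann2_verts_def vec.subspace_inter)
  have zero: "vec.dim (U \<inter> W) = 0 \<longleftrightarrow> (\<forall>a. a \<in> U \<and> a \<in> W \<longrightarrow> a = 0)"
    by (auto simp: vec.dim_eq_0)
  have le: "vec.dim (U \<inter> W) \<le> 2"
    using vec.dim_subset[of "U \<inter> W" U] d by simp
  have two: "vec.dim (U \<inter> W) = 2 \<longleftrightarrow> U = W"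
  proof
    assume "vec.dim (U \<inter> W) = 2"
    then have "U \<inter> W = U" "U \<inter> W = W"
      using s d by (intro vec.subspace_dim_equal; simp)+
    then show "U = W" by blast
  qed (simp add: d)
  show ?thesis
  proof -
    have "vec.dim (U \<inter> W) = 1 \<longleftrightarrow> vec.dim (U \<inter> W) \<noteq> 2 \<and> vec.dim (U \<inter> W) \<noteq> 0"
      using le by linarith
    then show ?thesis
      unfolding grassmann2_adj_def zero two by blast
  qed
qed

lemma dim_insert_le:
  "vec.dim (insert (a::'a::field^'n::finite) S) \<le> Suc (vec.dim S)"
  by (simp add: vec.dim_insert)

theorem theorem6p2:
  assumes "CARD('n::finite) \<ge> 4"
  shows "\<not> triply_transitive
           (grassmann2_verts :: ('a::{field,finite}^'n) set set) grassmann2_adj"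
proof
  let ?V = "grassmann2_verts :: ('a^'n) set set"
  assume "triply_transitive ?V grassmann2_adj"
  then obtain \<omega> where \<omega>: "\<omega> \<in> ?V"
    and T: "triple_span ?V grassmann2_adj \<omega> = terwilliger_algebra ?V grassmann2_adj \<omega>"
    unfolding triply_transitive_def by blast
  have s: "vec.subspace \<omega>" and d: "vec.dim \<omega> = 2"
    using \<omega> by (auto simp: grassmann2_verts_def)
  \<comment> \<open>This supplies the independent vectors \<open>u\<close>, \<open>v\<close>,
    \<open>w\<close>, \<open>t\<close> one after another.\<close>
  have proper: "\<exists>a. a \<in> U \<and> a \<notin> vec.span S"
    if "vec.dim S < vec.dim U" for U S :: "('a^'n) set"
    using that vec.dim_subset[of U "vec.span S"] by (auto simp: not_less[symmetric])
  obtain u where u: "u \<in> \<omega>" "u \<noteq> 0"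
    using proper[of "{}" \<omega>] d by auto
  have d1: "vec.dim {u} = 1"
    using u by (simp add: vec.dim_insert)
  then obtain v where v: "v \<in> \<omega>" "v \<notin> vec.span {u}"
    using proper[of "{u}" \<omega>] d by auto
  have d2: "vec.dim {u, v} = 2"
    using d1 v by (simp add: insert_commute[of u] vec.dim_insert)
  have \<omega>_eq: "\<omega> = vec.span {u, v}"
    using u v s d d2 by (intro vec.subspace_dim_equal[symmetric])
      (auto simp: vec.span_minimal)
  have dU: "vec.dim (UNIV :: ('a^'n) set) \<ge> 4"
    using assms by (simp add: vec.dim_UNIV dimension_def card_cart_basis vec.dimension_def)
  obtain w where w: "w \<notin> vec.span {u, v}"
    using proper[of "{u, v}" UNIV] d2 dU by auto
  have d3: "vec.dim {w, u, v} = 3"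
    using d2 w by (simp add: vec.dim_insert[of w])
  \<comment> \<open>Here \<open>n \<ge> 4\<close> enters: \<open>t\<close> leads out of the
    projective plane \<open>vec.span {w, u, v}\<close>.\<close>
  then obtain t where t: "t \<notin> vec.span {w, u, v}"
    using proper[of "{w, u, v}" UNIV] dU by auto
  have d4: "vec.dim {t, w, u, v} = 4"
    using d3 t by (simp add: vec.dim_insert[of t])

  \<comment> \<open>The common point \<open>p\<close> is spanned by \<open>u\<close>. The lines
    \<open>\<omega>\<close>, \<open>x\<close>, \<open>y\<close> are coplanar, whereas
    \<open>\<omega>\<close>, \<open>x\<close>, \<open>y'\<close> are not. The line \<open>z0\<close>
    lies in the plane of the first three, avoids \<open>u\<close>, and meets them in
    \<open>v\<close>, \<open>w\<close> and \<open>v + w\<close>.\<close>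
  define x where "x = vec.span {u, w}"
  define y where "y = vec.span {u, v + w}"
  define y' where "y' = vec.span {u, t}"
  define z0 where "z0 = vec.span {v, w}"
  have mem: "u \<in> \<omega>" "v \<in> \<omega>" "u \<in> x" "w \<in> x" "u \<in> y" "v + w \<in> y" "u \<in> y'" "t \<in> y'"
      "v \<in> z0" "w \<in> z0" "v + w \<in> z0"
    by (auto simp: \<omega>_eq x_def y_def y'_def z0_def vec.span_base intro: vec.span_add)
  have v0: "v \<noteq> 0"
    using v vec.span_zero by metis
  have w_u: "w \<notin> vec.span {u}" and w_v: "w \<notin> vec.span {v}"
    using w vec.span_mono[of "{u}" "{u, v}"] vec.span_mono[of "{v}" "{u, v}"] by auto
  have vw_\<omega>: "v + w \<notin> \<omega>"
    using w v s vec.subspace_diff[of \<omega> "v + w" v] \<omega>_eq by auto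
  then have vw: "v + w \<notin> vec.span {u}" "v + w \<noteq> 0"
    using vec.span_mono[of "{u}" "{u, v}"] s by (auto simp: \<omega>_eq vec.span_zero)
  \<comment> \<open>By exchange, \<open>v\<close> in the span of \<open>u\<close> and
    \<open>w\<close> but not of \<open>u\<close> would put \<open>w\<close> into
    \<open>\<omega>\<close>.\<close>
  have v_x: "v \<notin> x"
    using vec.in_span_insert[of v w "{u}"] v w by (auto simp: x_def insert_commute)
  have vw_x: "v + w \<notin> x"
    using v_x mem(4) vec.span_diff[of "v + w" "{u, w}" w] by (auto simp: x_def)
  have t_\<omega>: "t \<notin> \<omega>" and t_x: "t \<notin> x"
    using t vec.span_mono[of "{u, v}" "{w, u, v}"] vec.span_mono[of "{u, w}" "{w, u, v}"]
    by (auto simp: \<omega>_eq x_def)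
  have t_u: "t \<notin> vec.span {u}"
    using t_\<omega> vec.span_mono[of "{u}" "{u, v}"] by (auto simp: \<omega>_eq)
  have u_v: "u \<notin> vec.span {v}"
    using vec.in_span_insert[of u v "{}"] u v by auto
  have u_z0: "u \<notin> z0"
    using vec.in_span_insert[of u w "{v}"] u_v w by (auto simp: z0_def insert_commute)
  have V: "x \<in> ?V" "y \<in> ?V" "y' \<in> ?V" "z0 \<in> ?V"
    unfolding x_def y_def y'_def z0_def
    using u v0 w_u vw t_u w_v by (auto intro!: span_pair_in_grassmann2_verts)
  have ne: "\<omega> \<noteq> x" "\<omega> \<noteq> y" "x \<noteq> y" "\<omega> \<noteq> y'" "x \<noteq> y'"
    using mem v_x vw_\<omega> vw_x t_\<omega> t_x by auto
  have w0: "w \<noteq> 0"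
    using w_u vec.span_zero by metis
  let ?N = "\<lambda>y. {z \<in> ?V. grassmann2_adj x z \<and> grassmann2_adj \<omega> z \<and> grassmann2_adj z y}"
  have "card (?N y) = card (?N y')"
  proof (rule card_common_neighbours_eq[OF T \<omega> V(1,2,1,3)])
    show "\<not> grassmann2_adj z z" if "z \<in> ?V" for z
      using that by (simp add: grassmann2_adj_iff)
  qed (use \<omega> V ne mem u in \<open>auto simp: grassmann2_adj_iff\<close>)
  moreover have "card (?N y') < card (?N y)"
  proof -
    \<comment> \<open>The pencil of lines through \<open>u\<close>: with three lines removed, it
      bounds the count for \<open>y'\<close> from above and, together with \<open>z0\<close>, the
      count for \<open>y\<close> from below.\<close>
    define P where "P = {z \<in> ?V. u \<in> z}"
    have sub': "?N y' \<subseteq> P - {\<omega>, x, y'}"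
    proof
      fix z assume z: "z \<in> ?N y'"
      then have zV: "z \<in> ?V" and zd: "vec.dim z = 2" and zne: "z \<notin> {\<omega>, x, y'}"
        using \<omega> V by (auto simp: grassmann2_adj_iff grassmann2_verts_def)
      have "u \<in> z"
      proof (rule ccontr)
        assume "u \<notin> z"
        \<comment> \<open>If \<open>z\<close> avoided \<open>u\<close>, this space would have
          dimension at most 3. Yet it contains every line that joins \<open>u\<close> to a point of
          \<open>z\<close>, hence all of \<open>\<omega>\<close>, \<open>x\<close>,
          \<open>y'\<close>, which together span dimension 4.\<close>
        let ?Z = "vec.span (insert u z)"
        have meet: "s \<in> ?Z" if "a \<in> z" "a \<noteq> 0" "a \<in> vec.span {u, s}" for a s
        proof -
          \<comment> \<open>A nonzero multiple of \<open>u\<close> in \<open>z\<close> would put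
            \<open>u\<close> into \<open>z\<close>. So \<open>a\<close> can be exchanged for
            \<open>s\<close>.\<close>
          have "a \<notin> vec.span {u}"
          proof
            assume "a \<in> vec.span {u}"
            then have "u \<in> vec.span {a}"
              using vec.in_span_insert[of a u "{}"] \<open>a \<noteq> 0\<close> by auto
            then show False
              using zV \<open>a \<in> z\<close> \<open>u \<notin> z\<close> vec.span_minimal[of "{a}" z]
              by (auto simp: grassmann2_verts_def)
          qed
          then have "s \<in> vec.span {a, u}"
            using vec.in_span_insert[of a s "{u}"] that(3) by (auto simp: insert_commute)
          then show ?thesis
            using vec.span_mono[of "{a, u}" "insert u z"] \<open>a \<in> z\<close> by auto
        qed
        have "v \<in> ?Z" "w \<in> ?Z" "t \<in> ?Z"
          using z \<omega> V by (auto simp: grassmann2_adj_iff \<omega>_eq x_def y'_def intro: meet)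
        then have "{t, w, u, v} \<subseteq> ?Z"
          by (auto intro: vec.span_base)
        then have "4 \<le> vec.dim (insert u z)"
          using vec.dim_subset[of "{t, w, u, v}" ?Z] d4 by simp
        then show False
          using dim_insert_le[of u z] zd by simp
      qed
      then show "z \<in> P - {\<omega>, x, y'}"
        using zV zne by (simp add: P_def)
    qed
    \<comment> \<open>The lines of the pencil share \<open>u\<close> with \<open>\<omega>\<close>,
      \<open>x\<close> and \<open>y\<close>. One line off the pencil, \<open>z0\<close>, is enough
      for a strict inequality.\<close>
    have "insert z0 (P - {\<omega>, x, y}) \<subseteq> ?N y"
    proof -
      have "z0 \<noteq> \<omega>" "z0 \<noteq> x" "z0 \<noteq> y"
        using u_z0 mem by auto
      then show ?thesis
        using \<omega> V mem u v0 w0 vw(2) by (auto simp: P_def grassmann2_adj_iff)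
    qed
    then have "card (insert z0 (P - {\<omega>, x, y})) \<le> card (?N y)"
      by (intro card_mono) auto
    moreover have "card (insert z0 (P - {\<omega>, x, y})) = Suc (card (P - {\<omega>, x, y}))"
      using u_z0 by (simp add: P_def)
    \<comment> \<open>Both triples consist of three distinct lines of the pencil.\<close>
    moreover have "card (P - {\<omega>, x, y}) = card (P - {\<omega>, x, y'})"
    proof -
      have "{\<omega>, x, y} \<subseteq> P" "{\<omega>, x, y'} \<subseteq> P" "card {\<omega>, x, y} = card {\<omega>, x, y'}"
        using \<omega> V mem ne by (auto simp: P_def)
      then show ?thesis
        by (simp add: card_Diff_subset)
    qed
    moreover have "card (?N y') \<le> card (P - {\<omega>, x, y'})"
      using sub' by (intro card_mono) auto
    ultimately show ?thesis
      by linarith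
  qed
  ultimately show False
    by simp
qed

end
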